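(* Let $2\le k<n$ be integers and let $\mu$ be a nonzero finite, radially symmetric, compactly supported Borel measure on $\mathbb R^n$ that is not concentrated at the origin (i.e. $\mu$ is not a multiple of the delta-measure at the origin). Then the $t$-neighborhood waist theorem fails for $\mu$ and maps $\mathbb R^n\to\mathbb R^k$; that is, there exists a continuous map $f:\mathbb R^n\to\mathbb R^k$ such that for every $y\in\mathbb R^k$ there exists $t>0$ with $$\mu(f^{-1}(y)+t)<\mu(\mathbb R^{n-k}+t).$$
   Context: A measure on $\mathbb R^n$ is radially symmetric if it is invariant under all orthogonal transformations of $\mathbb R^n$. For $X\subset\mathbb R^n$ and $t>0$, $X+t$ denotes the $t$-neighborhood of $X$ in the Euclidean metric (the set of points at distance at most $t$ from $X$; empty if $X$ is empty). $\mathbb R^{n-k}\subset\mathbb R^n$ denotes any $(n-k)$-dimensional linear subspace (the choice is irrelevant by radial symmetry). The $t$-neighborhood waist theorem for a finite Borel measure $\mu$ on $\mathbb R^n$ and maps $\mathbb R^n\to\mathbb R^k$ is the statement that for every continuous $f:\mathbb R^n\to\mathbb R^k$ there exists $y\in\mathbb R^k$ such that for every $t>0$ one has $\mu(f^{-1}(y)+t)\ge\mu(\mathbb R^{n-k}+t)$. *)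

theory Defs
  imports "HOL-Analysis.Analysis" "HOL-Probability.Giry_Monad"
begin

definition radially_symmetric :: "('a::euclidean_space) measure \<Rightarrow> bool" where
  "radially_symmetric M \<longleftrightarrow> (\<forall>T. orthogonal_transformation T \<longrightarrow> distr M borel T = M)"

definition measure_support :: "('a::topological_space) measure \<Rightarrow> 'a set" where
  "measure_support M = {x. \<forall>U. open U \<longrightarrow> x \<in> U \<longrightarrow> emeasure M U \<noteq> 0}"

text \<open>The guard \<open>X \<noteq> {}\<close> is needed because \<open>infdist x {} = 0\<close>; the neighborhood of the
  empty set is empty.\<close>

definition neighborhood :: "('a::metric_space) set \<Rightarrow> real \<Rightarrow> 'a set" where
  "neighborhood X t = {x. X \<noteq> {} \<and> infdist x X \<le> t}"

end

theory Submission
  imports Defs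
begin

text \<open>
  The map \<open>f x = (norm x, x\<^sub>m, 0, \<dots>, 0)\<close> is a counterexample to the waist theorem, for any
  coordinate \<open>x\<^sub>m\<close> of \<open>x\<close>. Let \<open>R > 0\<close> be the largest norm of a point in the support of the
  measure. By radial symmetry the whole sphere of radius \<open>R\<close> lies in the support (lemma
  \<open>outer_sphere_in_support\<close>), so every open set that meets this sphere has positive measure, while
  the complement of the ball of radius \<open>R\<close> is null.

  The subspace \<open>L\<close> has the ball of radius \<open>R\<close> inside its \<open>R\<close>-neighborhood, which therefore has
  full measure. A nonempty fiber of \<open>f\<close> over \<open>y \<noteq> 0\<close> lies in a sphere of radius \<open>r > 0\<close> about the
  origin and in a half-space \<open>{z. z \<bullet> x \<le> 0}\<close>, where \<open>x\<close> is \<open>R\<close> or \<open>-R\<close> times the \<open>m\<close>-th unit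
  vector. All its points \<open>z\<close> satisfy \<open>\<bar>z - x\<bar>\<^sup>2 \<ge> R\<^sup>2 + r\<^sup>2\<close>, so its \<open>R\<close>-neighborhood misses a ball
  about the point \<open>x\<close> of the support, and \<open>t = R\<close> gives a strict inequality.

  The fiber over \<open>0\<close> is just the origin. For it \<open>t = R/2\<close> works: its neighborhood is a ball that
  stays away from the sphere of radius \<open>R\<close>, whereas the neighborhood of \<open>L\<close> contains that ball and
  also a ball about a point of \<open>L\<close> on the sphere. Here \<open>k < n\<close> enters, as \<open>L\<close> has to contain
  nonzero vectors; \<open>k \<ge> 2\<close> is what allows the coordinate \<open>x\<^sub>m\<close> to cut the spheres on which the
  norm is constant.
\<close>

section \<open>The support of a measure\<close>

text \<open>The complement of the support is the union of all open null sets, and in a second countable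
  space countably many of them already cover it.\<close>

lemma null_outside_support:
  fixes M :: "'a::second_countable_topology measure"
  assumes "sets M = sets borel"
  shows "- measure_support M \<in> null_sets M"
proof -
  let ?F = "{U. open U \<and> emeasure M U = 0}"
  obtain F where F: "F \<subseteq> ?F" "countable F" "\<Union>F = \<Union>?F"
    using Lindelof[of ?F] by blast
  have "- measure_support M = \<Union>F"
    unfolding F(3) measure_support_def by auto
  moreover have "(\<Union>U\<in>F. U) \<in> null_sets M"
    using F(1) assms by (intro null_sets_UN' F(2)) (auto simp: null_sets_def)
  ultimately show ?thesis by simp
qed

lemma emeasure_eq_scaled_return_if_support_subset:
  fixes M :: "'a::{second_countable_topology, t1_space} measure"
  assumes "sets M = sets borel" and "measure_support M \<subseteq> {a}"
  shows "M = scale_measure (emeasure M UNIV) (return borel a)"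
proof (rule measure_eqI)
  have "- {a} \<subseteq> - measure_support M" and "- {a} \<in> sets M"
    using assms by auto
  then have null: "- {a} \<in> null_sets M"
    using null_outside_support[OF assms(1)] null_sets_subset by blast
  fix A assume "A \<in> sets M"
  then have A: "A \<in> sets borel" using assms(1) by simp
  show "emeasure M A = emeasure (scale_measure (emeasure M UNIV) (return borel a)) A"
  proof (cases "a \<in> A")
    case True
    then have "A \<union> - {a} = UNIV" by auto
    then have "emeasure M A = emeasure M UNIV"
      using emeasure_Un_null_set[OF \<open>A \<in> sets M\<close> null] by simp
    then show ?thesis using True A by simp
  next
    case False
    then have "A \<subseteq> - {a}" by auto
    then have "emeasure M A = 0"
      using null_sets_subset[OF null \<open>A \<in> sets M\<close>] by blast
    then show ?thesis using False A by simp
  qed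
qed (simp add: assms(1))

lemma orthogonal_image_in_support:
  fixes M :: "'a::euclidean_space measure"
  assumes "sets M = sets borel" and "radially_symmetric M"
    and "orthogonal_transformation T" and "x \<in> measure_support M"
  shows "T x \<in> measure_support M"
  unfolding measure_support_def
proof (intro CollectI allI impI)
  fix U assume U: "open U" "T x \<in> U"
  have cont: "continuous_on UNIV T"
    using assms(3) by (simp add: linear_continuous_on linear_linear orthogonal_transformation_linear)
  have sp: "space M = UNIV"
    using sets_eq_imp_space_eq[OF assms(1)] by simp
  have "T \<in> measurable M borel"
    using borel_measurable_continuous_onI[OF cont] measurable_cong_sets[OF assms(1) refl] by blast
  then have "emeasure (distr M borel T) U = emeasure M (T -` U)"
    using U(1) sp by (simp add: emeasure_distr)
  then have "emeasure M U = emeasure M (T -` U)"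
    using assms(2,3) by (simp add: radially_symmetric_def)
  moreover have "open (T -` U)" and "x \<in> T -` U"
    using U open_vimage[OF U(1) cont] by auto
  ultimately show "emeasure M U \<noteq> 0"
    using assms(4) by (auto simp: measure_support_def)
qed

text \<open>Compactness provides a point of maximal norm in the support, and the orthogonal group is
  transitive on each sphere.\<close>

lemma outer_sphere_in_support:
  fixes M :: "(real ^ 'n) measure"
  assumes "sets M = sets borel" and "radially_symmetric M"
    and "compact (measure_support M)" and "\<not> measure_support M \<subseteq> {0}"
  obtains R where "R > 0" and "sphere 0 R \<subseteq> measure_support M"
    and "measure_support M \<subseteq> cball 0 R"
proof -
  from assms(4) obtain z where z: "z \<in> measure_support M" "z \<noteq> 0" by auto
  obtain p where p: "p \<in> measure_support M" "\<forall>y\<in>measure_support M. norm y \<le> norm p"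
    using continuous_attains_sup[OF assms(3), of norm] z(1) continuous_on_norm_id by blast
  show thesis
  proof
    show "norm p > 0" using p(2) z by fastforce
    show "measure_support M \<subseteq> cball 0 (norm p)" using p(2) by auto
    show "sphere 0 (norm p) \<subseteq> measure_support M"
    proof
      fix x :: "real ^ 'n" assume "x \<in> sphere 0 (norm p)"
      then obtain T where "orthogonal_transformation T" "T p = x"
        using orthogonal_transformation_exists[of p x] by auto
      then show "x \<in> measure_support M"
        using orthogonal_image_in_support[OF assms(1,2) _ p(1)] by blast
    qed
  qed
qed

section \<open>Neighborhoods\<close>

lemma closed_neighborhood: "closed (neighborhood X t)"
  unfolding neighborhood_def
  by (cases "X = {}") (auto intro!: closed_Collect_le continuous_intros)

lemma cball_subset_neighborhood: "x \<in> X \<Longrightarrow> cball x t \<subseteq> neighborhood X t"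
  unfolding neighborhood_def by (auto simp: dist_commute intro: infdist_le2)

lemma neighborhood_disjoint_ball:
  assumes "\<And>z. z \<in> X \<Longrightarrow> dist z x \<ge> t + d"
  shows "neighborhood X t \<inter> ball x d = {}"
proof -
  have "\<not> infdist w X \<le> t" if "dist x w < d" and "X \<noteq> {}" for w
  proof -
    have "infdist x X \<ge> t + d"
      using assms that(2) by (simp add: infdist_notempty cINF_greatest dist_commute)
    then show ?thesis
      using infdist_triangle[of x X w] that(1) by linarith
  qed
  then show ?thesis unfolding neighborhood_def by force
qed

section \<open>Comparison of measures of neighborhoods\<close>

text \<open>Both instances of this lemma share the mechanism: inside the support, \<open>B\<close> contains \<open>A\<close> as
  well as a ball about a support point that \<open>A\<close> leaves out, and such a ball carries positive
  measure. Containment is required only on the support, because outside it the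
  neighborhood of a fiber on a large sphere need not lie in that of \<open>L\<close>.\<close>

lemma measure_less_if_misses_ball_at_support:
  fixes M :: "'a::{metric_space, second_countable_topology} measure"
  assumes "sets M = sets borel" and "finite_measure M"
    and "closed A" and "closed B"
    and "x \<in> measure_support M" and "d > 0"
    and "A \<inter> ball x d = {}"
    and "measure_support M \<inter> (A \<union> ball x d) \<subseteq> B"
  shows "measure M A < measure M B"
proof -
  interpret finite_measure M by fact
  let ?N = "- measure_support M"
  have N: "?N \<in> null_sets M" by (rule null_outside_support[OF assms(1)])
  have meas: "A \<in> sets M" "B \<in> sets M" "ball x d \<in> sets M"
    using assms by auto
  have "emeasure M (ball x d) \<noteq> 0"
    using assms(5,6) by (auto simp: measure_support_def)
  then have "0 < measure M (ball x d)"
    by (simp add: emeasure_eq_measure order_less_le)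
  then have "measure M A < measure M A + measure M (ball x d)" by simp
  also have "\<dots> = measure M (A \<union> ball x d)"
    using meas assms(7) by (simp add: finite_measure_Union)
  also have "\<dots> \<le> measure M (B \<union> ?N)"
    using meas N assms(8) by (intro finite_measure_mono) auto
  also have "\<dots> = measure M B"
    using meas N by (simp only: measure_Un_null_set)
  finally show ?thesis .
qed

section \<open>The counterexample\<close>

lemma dist_ge_if_inner_nonpos:
  fixes x z :: "'a::real_inner"
  assumes "z \<bullet> x \<le> 0"
  shows "dist z x \<ge> sqrt ((norm x)\<^sup>2 + (norm z)\<^sup>2)"
proof -
  have "(dist z x)\<^sup>2 = (norm x)\<^sup>2 + (norm z)\<^sup>2 - 2 * (z \<bullet> x)"
    by (simp add: dist_norm power2_norm_eq_inner inner_diff inner_commute)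
  then show ?thesis
    using assms by (intro real_le_lsqrt) auto
qed

theorem theorem3p2:
  fixes \<mu> :: "(real ^ 'n) measure" and L :: "(real ^ 'n) set"
  assumes "2 \<le> CARD('k::finite)" and "CARD('k) < CARD('n::finite)"
    and "sets \<mu> = sets borel" and "finite_measure \<mu>"
    and "emeasure \<mu> UNIV \<noteq> 0"
    and "radially_symmetric \<mu>"
    and "compact (measure_support \<mu>)"
    and "\<forall>c. \<mu> \<noteq> scale_measure c (return borel 0)"
    and "subspace L" and "dim L = CARD('n) - CARD('k)"
  shows "\<exists>f :: real ^ 'n \<Rightarrow> real ^ 'k. continuous_on UNIV f \<and>
    (\<forall>y. \<exists>t>0. measure \<mu> (neighborhood (f -` {y}) t) < measure \<mu> (neighborhood L t))"
proof -
  have "\<not> measure_support \<mu> \<subseteq> {0}"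
    using emeasure_eq_scaled_return_if_support_subset[OF assms(3)] assms(8) by blast
  then obtain R where R: "R > 0" and sphere: "sphere 0 R \<subseteq> measure_support \<mu>"
    and supp: "measure_support \<mu> \<subseteq> cball 0 R"
    using outer_sphere_in_support[OF assms(3,6,7)] by blast
  have "\<not> L \<subseteq> {0}"
    using dim_eq_0[of L] assms(2,10) by simp
  then obtain v where v: "v \<in> L" "v \<noteq> 0" by auto
  define p where "p = (R / norm v) *\<^sub>R v"
  have p: "p \<in> L" "norm p = R"
    using v R assms(9) by (auto simp: p_def subspace_scale)
  have L0: "0 \<in> L" using assms(9) by (rule subspace_0)
  obtain i j :: 'k where ij: "i \<noteq> j"
    using assms(1) card_le_Suc0_iff_eq[of "UNIV :: 'k set"] by (auto simp: numeral_2_eq_2)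
  obtain m :: 'n where "m \<in> UNIV" by blast
  define f :: "real ^ 'n \<Rightarrow> real ^ 'k" where "f = (\<lambda>x. norm x *\<^sub>R axis i 1 + (x $ m) *\<^sub>R axis j 1)"
  have fi: "f x $ i = norm x" and fj: "f x $ j = x $ m" for x
    using ij by (auto simp: f_def axis_def)
  have f0: "f x = 0 \<longleftrightarrow> x = 0" for x
    using fi[of x] by (auto simp: f_def axis_def vec_eq_iff)
  have "continuous_on UNIV f"
    unfolding f_def by (intro continuous_intros)
  moreover have "\<exists>t>0. measure \<mu> (neighborhood (f -` {y}) t) < measure \<mu> (neighborhood L t)" for y
  proof (cases "y = 0")
    case True
    then have "f -` {y} = {0}" using f0 by auto
    then have fiber: "neighborhood (f -` {y}) (R/2) = cball 0 (R/2)"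
      by (auto simp: neighborhood_def dist_commute)
    have "measure \<mu> (cball 0 (R/2)) < measure \<mu> (neighborhood L (R/2))"
    proof (rule measure_less_if_misses_ball_at_support[OF assms(3,4) _ closed_neighborhood])
      show "p \<in> measure_support \<mu>" using p sphere by auto
      show "cball 0 (R/2) \<inter> ball p (R/2) = {}"
      proof -
        have "\<not> dist p w < R/2" if "norm w \<le> R/2" for w
          using norm_triangle_sub[of p w] that p(2) by (simp add: dist_norm)
        then show ?thesis by auto
      qed
      show "measure_support \<mu> \<inter> (cball 0 (R/2) \<union> ball p (R/2)) \<subseteq> neighborhood L (R/2)"
        using cball_subset_neighborhood[OF L0, of "R/2"]
          cball_subset_neighborhood[OF p(1), of "R/2"] ball_subset_cball[of p "R/2"] by blast
    qed (use R in auto)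
    then show ?thesis using R fiber by (intro exI[of _ "R/2"]) simp
  next
    case False
    \<comment> \<open>The sign is opposite to that of the \<open>m\<close>-th coordinate on the fiber.\<close>
    define x :: "real ^ 'n" where "x = (if y $ j \<ge> 0 then - R else R) *\<^sub>R axis m 1"
    have x: "norm x = R"
      using R by (simp add: x_def)
    have inner: "z \<bullet> x \<le> 0" if "f z = y" for z
      using fj[of z] that R by (auto simp: x_def inner_axis mult_nonneg_nonpos mult_nonpos_nonneg)
    \<comment> \<open>If \<open>y $ i = 0\<close>, then the fiber is empty and any \<open>d > 0\<close> does.\<close>
    obtain d where d: "d > 0" and far: "\<And>z. f z = y \<Longrightarrow> dist z x \<ge> R + d"
    proof (cases "y $ i = 0")
      case True
      then have "f z \<noteq> y" for z using False f0[of z] fi[of z] by auto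
      then show thesis using that[of 1] by simp
    next
      case False
      have "R < sqrt (R\<^sup>2 + (y $ i)\<^sup>2)"
        using False R by (intro real_less_rsqrt) simp
      moreover have "sqrt (R\<^sup>2 + (y $ i)\<^sup>2) \<le> dist z x" if "f z = y" for z
        using dist_ge_if_inner_nonpos[OF inner[OF that]] fi[of z] that x by simp
      ultimately show thesis
        using that[of "sqrt (R\<^sup>2 + (y $ i)\<^sup>2) - R"] by simp
    qed
    have "measure \<mu> (neighborhood (f -` {y}) R) < measure \<mu> (neighborhood L R)"
    proof (rule measure_less_if_misses_ball_at_support
        [OF assms(3,4) closed_neighborhood closed_neighborhood _ d])
      show "x \<in> measure_support \<mu>" using x sphere by auto
      show "neighborhood (f -` {y}) R \<inter> ball x d = {}"
        using far by (intro neighborhood_disjoint_ball) auto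
      show "measure_support \<mu> \<inter> (neighborhood (f -` {y}) R \<union> ball x d) \<subseteq> neighborhood L R"
        using supp cball_subset_neighborhood[OF L0, of R] by blast
    qed
    then show ?thesis using R by blast
  qed
  ultimately show ?thesis by blast
qed

end
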